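(* Let $\alpha_1,\beta_1,\beta_2>0$ and $B_1\ge0$ with $\alpha_1\ge\beta_2$. For $b>0$ let $$\tilde\Psi(b;z)=\Gamma(b)\sum_{k=0}^\infty\frac{\Gamma(\alpha_1+k)}{\Gamma(b+kB_1)\,\Gamma(\beta_2+k)}\frac{z^k}{k!}.$$ Then for all $z\in(0,\infty)$ $$\frac{\tilde\Psi(\beta_1+1;z)}{\tilde\Psi(\beta_1;z)}+\Bigg[\frac{\Gamma(\beta_2)}{\Gamma(\alpha_1)}\,\tilde\Psi(\beta_1+1;z)\Bigg]^{\frac{B_1}{\beta_1}}\ge2.$$
   Context: In the paper's notation $\tilde\Psi(b;z)={}_1\tilde\Psi_2\Big[\begin{matrix}(\alpha_1,1)\\ (b,B_1),(\beta_2,1)\end{matrix}\Big|z\Big]$, where ${}_p\tilde\Psi_q$ is the Fox-Wright function ${}_p\Psi_q\Big[\begin{matrix}(\alpha_1,A_1),\dots,(\alpha_p,A_p)\\ (\beta_1,B_1),\dots,(\beta_q,B_q)\end{matrix}\Big|z\Big]=\sum_{k=0}^\infty\frac{\prod_{l=1}^p\Gamma(\alpha_l+kA_l)}{\prod_{l=1}^q\Gamma(\beta_l+kB_l)}\frac{z^k}{k!}$ multiplied by $\Gamma$ of its first lower parameter. *)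

theory Defs
  imports "HOL-Analysis.Analysis"
begin

text \<open>
  The upper and lower parameters are given as lists of pairs \<open>(\<alpha>\<^sub>l, A\<^sub>l)\<close> and \<open>(\<beta>\<^sub>l, B\<^sub>l)\<close>.
\<close>

definition fox_wright :: "(real \<times> real) list \<Rightarrow> (real \<times> real) list \<Rightarrow> real \<Rightarrow> real" where
  "fox_wright us ls z =
     (\<Sum>k. (\<Prod>(a, A)\<leftarrow>us. Gamma (a + real k * A)) / (\<Prod>(b, B)\<leftarrow>ls. Gamma (b + real k * B)) *
          (z ^ k / fact k))"

text \<open>The normalisation multiplies by \<open>\<Gamma>\<close> of the first lower parameter only.\<close>

definition fox_wright_norm :: "(real \<times> real) list \<Rightarrow> (real \<times> real) list \<Rightarrow> real \<Rightarrow> real" where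
  "fox_wright_norm us ls z = Gamma (fst (hd ls)) * fox_wright us ls z"

definition Psi_tilde :: "real \<Rightarrow> real \<Rightarrow> real \<Rightarrow> real \<Rightarrow> real \<Rightarrow> real" where
  "Psi_tilde \<alpha>1 \<beta>2 B1 b z = fox_wright_norm [(\<alpha>1, 1)] [(b, B1), (\<beta>2, 1)] z"

lemma Psi_tilde_series:
  "Psi_tilde \<alpha>1 \<beta>2 B1 b z =
     Gamma b * (\<Sum>k. Gamma (\<alpha>1 + real k) / (Gamma (b + real k * B1) * Gamma (\<beta>2 + real k)) *
                     (z ^ k / fact k))"
  by (simp add: Psi_tilde_def fox_wright_norm_def fox_wright_def)

end

theory Submission
  imports Defs
begin

text \<open>
  Write \<open>t = B\<^sub>1 / \<beta>\<^sub>1\<close> and let \<open>g\<close> be the series of \<open>\<beta>\<^sub>1 + 1\<close>, scaled to have constant term \<open>1\<close>.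
  It is the exponential generating function of a sequence \<open>a\<close> with
  \<open>a\<^sub>k = const \<cdot> \<Gamma>(\<alpha>\<^sub>1 + k) / (\<Gamma>(\<beta>\<^sub>2 + k) \<Gamma>(\<beta>\<^sub>1 + 1 + k B\<^sub>1))\<close>. By the functional equation of \<open>\<Gamma>\<close>, lowering
  \<open>\<beta>\<^sub>1 + 1\<close> to \<open>\<beta>\<^sub>1\<close> multiplies the \<open>k\<close>-th term by \<open>1 + t k\<close>, which on power series is the operator
  \<open>1 + t z d/dz\<close>. So the claim reads
  \<open>g / (g + t z g') + g\<^sup>t \<ge> 2\<close>.

  The sequence \<open>a\<close> is log-concave: the quotients \<open>(\<alpha>\<^sub>1 + k) / (\<beta>\<^sub>2 + k)\<close> decrease because
  \<open>\<alpha>\<^sub>1 \<ge> \<beta>\<^sub>2\<close>, and \<open>\<Gamma>\<close> is log-convex. A log-concave sequence has a generating function that is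
  log-concave on the positive half-line, because \<open>g' / g\<close> is a quotient of power series whose
  coefficient quotients \<open>a\<^sub>k\<^sub>+\<^sub>1 / a\<^sub>k\<close> decrease (\<open>egf_shift_quotient_antimono\<close>). As \<open>ln g\<close> vanishes
  at \<open>0\<close>, concavity gives \<open>z g' / g \<le> ln g\<close> (\<open>log_derivative_egf_le_ln\<close>).

  With \<open>u = t ln g \<ge> 0\<close> the first summand is therefore at least \<open>1 / (1 + u)\<close>, the second one is
  \<open>exp u \<ge> 1 + u\<close>, and a positive number and its reciprocal add up to at least \<open>2\<close>.
\<close>

section \<open>Generating functions of log-concave sequences\<close>

definition egf :: "(nat \<Rightarrow> real) \<Rightarrow> real \<Rightarrow> real" where
  "egf a x = (\<Sum>k. a k / fact k * x ^ k)"

text \<open>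
  Log-concavity is expressed by decreasing quotients \<open>a\<^sub>k\<^sub>+\<^sub>1 / a\<^sub>k\<close>. These are bounded by the first one,
  so \<open>a\<close> grows at most geometrically and the exponential series dominates.
\<close>

lemma summable_egf:
  fixes a :: "nat \<Rightarrow> real"
  assumes pos: "\<And>k. a k > 0" and dec: "decseq (\<lambda>k. a (Suc k) / a k)"
  shows "summable (\<lambda>k. a k / fact k * x ^ k)"
proof -
  define q where "q = a 1 / a 0"
  have q: "q > 0"
    using pos by (simp add: q_def)
  have le: "a k \<le> a 0 * q ^ k" for k
  proof (induction k)
    case (Suc k)
    have "a (Suc k) / a k \<le> q"
      using decseqD[OF dec, of 0 k] by (simp add: q_def)
    then have "a (Suc k) \<le> q * a k"
      using pos[of k] by (simp add: divide_le_eq)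
    also have "\<dots> \<le> q * (a 0 * q ^ k)"
      using Suc q by simp
    finally show ?case by (simp add: mult_ac)
  qed simp
  have "summable (\<lambda>k. a 0 * (inverse (fact k) * (q * \<bar>x\<bar>) ^ k))"
    by (intro summable_mult summable_exp)
  then show ?thesis
  proof (rule summable_comparison_test')
    fix k :: nat
    have "a k * (\<bar>x\<bar> ^ k / fact k) \<le> (a 0 * q ^ k) * (\<bar>x\<bar> ^ k / fact k)"
      using le by (intro mult_right_mono) auto
    then show "norm (a k / fact k * x ^ k) \<le> a 0 * (inverse (fact k) * (q * \<bar>x\<bar>) ^ k)"
      using pos[of k] by (simp add: abs_mult power_abs power_mult_distrib field_simps)
  qed
qed

lemma egf_pos:
  assumes pos: "\<And>k. a k > 0" and dec: "decseq (\<lambda>k. a (Suc k) / a k)" and "x \<ge> 0"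
  shows "egf a x \<ge> a 0" "egf a x > 0"
proof -
  have "(\<Sum>k<1. a k / fact k * x ^ k) \<le> egf a x"
    unfolding egf_def using pos \<open>x \<ge> 0\<close>
    by (intro sum_le_suminf summable_egf pos dec) (auto simp: less_imp_le)
  then show "egf a x \<ge> a 0" by simp
  with pos[of 0] show "egf a x > 0" by linarith
qed

lemma diffs_egf: "diffs (\<lambda>k. a k / fact k) = (\<lambda>k. a (Suc k) / fact k :: real)"
  by (rule ext) (simp add: diffs_def field_simps del: of_nat_Suc)

lemma DERIV_egf:
  assumes "\<And>x. summable (\<lambda>k. a k / fact k * x ^ k)"
  shows "DERIV (egf a) x :> egf (\<lambda>k. a (Suc k)) x"
  using termdiffs_strong_converges_everywhere[of "\<lambda>k. a k / fact k" x] assms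
  unfolding diffs_egf egf_def by simp

text \<open>
  This is log-concavity of \<open>egf a\<close>, since the shifted sequence generates the derivative.
  Let \<open>\<rho>\<close> be the quotient at \<open>y\<close>. The power series of \<open>egf a' - \<rho> egf a\<close> (\<open>a'\<close> the shifted sequence)
  vanishes at \<open>y\<close>, and its coefficients change sign at most once, from plus to minus. Passing from
  \<open>y\<close> down to \<open>x\<close> scales the \<open>k\<close>-th term by \<open>(x / y)\<^sup>k\<close>, which favours the early, positive terms, so
  the value at \<open>x\<close> is nonnegative.
\<close>

lemma egf_shift_quotient_antimono:
  assumes pos: "\<And>k. a k > 0" and dec: "decseq (\<lambda>k. a (Suc k) / a k)"
    and xy: "0 \<le> x" "x \<le> y"
  shows "egf (\<lambda>k. a (Suc k)) y / egf a y \<le> egf (\<lambda>k. a (Suc k)) x / egf a x"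
proof -
  define \<rho> where "\<rho> = egf (\<lambda>k. a (Suc k)) y / egf a y"
  define d where "d k = a k / fact k * (a (Suc k) / a k - \<rho>)" for k
  have dec': "decseq (\<lambda>k. a (Suc (Suc k)) / a (Suc k))"
    using dec by (simp add: decseq_def)
  have sums: "(\<lambda>k. d k * w ^ k) sums (egf (\<lambda>k. a (Suc k)) w - \<rho> * egf a w)" for w
  proof -
    have "(\<lambda>k. a (Suc k) / fact k * w ^ k - \<rho> * (a k / fact k * w ^ k))
        sums (egf (\<lambda>k. a (Suc k)) w - \<rho> * egf a w)"
      unfolding egf_def using summable_egf[of a w] summable_egf[of "\<lambda>k. a (Suc k)" w] pos dec dec'
      by (intro sums_diff sums_mult summable_sums) auto
    also have "(\<lambda>k. a (Suc k) / fact k * w ^ k - \<rho> * (a k / fact k * w ^ k)) = (\<lambda>k. d k * w ^ k)"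
      using pos by (auto simp: d_def fun_eq_iff field_simps less_imp_neq[symmetric])
    finally show ?thesis .
  qed
  have gpos: "egf a x > 0" "egf a y > 0"
    using egf_pos[OF pos dec] xy by auto
  have sum0: "(\<lambda>k. d k * y ^ k) sums 0"
    using sums[of y] gpos by (simp add: \<rho>_def)
  have "0 \<le> egf (\<lambda>k. a (Suc k)) x - \<rho> * egf a x"
  proof (cases "\<exists>m. a (Suc m) / a m < \<rho>")
    case False
    then have "d k \<ge> 0" for k
      using pos[of k] by (auto simp: d_def not_less less_imp_le)
    then show ?thesis
      using xy by (intro sums_le[OF _ sums_zero sums]) auto
  next
    case True
    define m where "m = (LEAST m. a (Suc m) / a m < \<rho>)"
    have below: "d k \<ge> 0" if "k < m" for k
      using not_less_Least[of k "\<lambda>m. a (Suc m) / a m < \<rho>"] that pos[of k]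
      by (auto simp: d_def m_def not_less less_imp_le)
    have "a (Suc m) / a m < \<rho>"
      unfolding m_def using True by (rule LeastI_ex)
    then have above: "d k \<le> 0" if "k \<ge> m" for k
      using decseqD[OF dec that] pos[of k]
      unfolding d_def by (intro mult_nonneg_nonpos) (auto simp: less_imp_le)
    \<comment> \<open>Comparison of \<open>(x / y) ^ k\<close> with its value at the sign change \<open>m\<close>, with denominators cleared\<close>
    have "y ^ m * x ^ k * d k \<ge> x ^ m * y ^ k * d k" for k
    proof (cases "k < m")
      case True
      have "x ^ k * y ^ k * y ^ (m - k) \<ge> x ^ k * y ^ k * x ^ (m - k)"
        using xy by (intro mult_left_mono power_mono) auto
      moreover have "x ^ m = x ^ k * x ^ (m - k)" "y ^ m = y ^ k * y ^ (m - k)"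
        using True by (simp_all flip: power_add)
      ultimately have "y ^ m * x ^ k \<ge> x ^ m * y ^ k"
        by (simp only: mult_ac)
      then show ?thesis
        using below[OF True] by (rule mult_right_mono)
    next
      case False
      have "x ^ m * y ^ m * y ^ (k - m) \<ge> x ^ m * y ^ m * x ^ (k - m)"
        using xy by (intro mult_left_mono power_mono) auto
      moreover have "x ^ k = x ^ m * x ^ (k - m)" "y ^ k = y ^ m * y ^ (k - m)"
        using False by (simp_all flip: power_add)
      ultimately have "y ^ m * x ^ k \<le> x ^ m * y ^ k"
        by (simp only: mult_ac)
      then show ?thesis
        using above[of k] False by (intro mult_right_mono_neg) auto
    qed
    then have "x ^ m * 0 \<le> y ^ m * (egf (\<lambda>k. a (Suc k)) x - \<rho> * egf a x)"
      by (intro sums_le[OF _ sums_mult[OF sum0] sums_mult[OF sums]]) (simp add: mult_ac)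
    moreover have "y ^ m > 0" if "x \<noteq> y"
      using that xy by simp
    ultimately show ?thesis
      using gpos by (cases "x = y") (auto simp: zero_le_mult_iff \<rho>_def)
  qed
  then show ?thesis
    using gpos unfolding \<rho>_def[symmetric] by (simp add: field_simps)
qed

text \<open>
  By the mean value theorem \<open>ln (egf a z)\<close> is \<open>z\<close> times the logarithmic derivative at some point
  before \<open>z\<close>, where that derivative is at least its value at \<open>z\<close>. Equality holds for \<open>a k = c ^ k\<close>, whose
  generating function is \<open>exp (c z)\<close>.
\<close>

lemma log_derivative_egf_le_ln:
  assumes pos: "\<And>k. a k > 0" and dec: "decseq (\<lambda>k. a (Suc k) / a k)"
    and "a 0 = 1" "z > 0"
  shows "z * (egf (\<lambda>k. a (Suc k)) z / egf a z) \<le> ln (egf a z)"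
proof -
  let ?Q = "\<lambda>x. egf (\<lambda>k. a (Suc k)) x / egf a x"
  have "((\<lambda>x. ln (egf a x)) has_real_derivative ?Q x) (at x)" if "0 \<le> x" for x
    using egf_pos[OF pos dec that]
    by (auto intro!: derivative_eq_intros DERIV_egf summable_egf pos dec)
  from MVT2[OF \<open>z > 0\<close> this] obtain w where w: "0 < w" "w < z"
      "ln (egf a z) - ln (egf a 0) = (z - 0) * ?Q w"
    by blast
  have "egf a 0 = 1"
    using powser_zero[of "\<lambda>k. a k / fact k"] \<open>a 0 = 1\<close> by (simp add: egf_def)
  then have "ln (egf a z) = z * ?Q w"
    using w by simp
  moreover have "z * ?Q z \<le> z * ?Q w"
    using w egf_shift_quotient_antimono[OF pos dec, of w z] \<open>z > 0\<close> by (intro mult_left_mono) auto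
  ultimately show ?thesis by simp
qed

text \<open>The factor \<open>1 + t k\<close> on coefficients is the operator \<open>1 + t z d/dz\<close>.\<close>

lemma sums_egf_affine:
  assumes "\<And>x. summable (\<lambda>k. a k / fact k * x ^ k)"
  shows "(\<lambda>k. (1 + t * real k) * (a k / fact k * z ^ k)) sums (egf a z + t * (z * egf (\<lambda>k. a (Suc k)) z))"
proof -
  have "summable (\<lambda>k. diffs (\<lambda>k. a k / fact k) k * z ^ k)"
    using assms by (intro termdiff_converges_all)
  from diffs_equiv[OF this]
  have "(\<lambda>k. t * (z * (real k * (a k / fact k) * z ^ (k - Suc 0)))) sums (t * (z * egf (\<lambda>k. a (Suc k)) z))"
    unfolding diffs_egf egf_def[symmetric] by (intro sums_mult)
  with summable_sums[OF assms[of z]]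
  have "(\<lambda>k. a k / fact k * z ^ k + t * (z * (real k * (a k / fact k) * z ^ (k - Suc 0))))
      sums (egf a z + t * (z * egf (\<lambda>k. a (Suc k)) z))"
    unfolding egf_def[symmetric] by (intro sums_add)
  also have "(\<lambda>k. a k / fact k * z ^ k + t * (z * (real k * (a k / fact k) * z ^ (k - Suc 0))))
      = (\<lambda>k. (1 + t * real k) * (a k / fact k * z ^ k))"
  proof
    fix k show "a k / fact k * z ^ k + t * (z * (real k * (a k / fact k) * z ^ (k - Suc 0)))
      = (1 + t * real k) * (a k / fact k * z ^ k)"
      by (cases k) (simp_all add: algebra_simps add_divide_distrib del: fact_Suc of_nat_Suc)
  qed
  finally show ?thesis .
qed

section \<open>Log-convexity of the Gamma function and the inequality\<close>

text \<open>Log-convexity of \<open>\<Gamma>\<close> at the midpoint \<open>x + h\<close> of \<open>x\<close> and \<open>x + 2 h\<close>.\<close>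

lemma Gamma_quotient_mono:
  fixes x h :: real
  assumes "x > 0" "h \<ge> 0"
  shows "Gamma (x + h) / Gamma (x + 2 * h) \<le> Gamma x / Gamma (x + h)"
proof -
  have pos: "Gamma x > 0" "Gamma (x + h) > 0" "Gamma (x + 2 * h) > 0"
    using assms by (auto intro!: Gamma_real_pos)
  have mid: "(1 / 2) * x + (1 / 2) * (x + 2 * h) = x + h"
    by (simp add: field_simps)
  have "ln (Gamma (x + h)) \<le> (1 - 1 / 2) * ln (Gamma x) + 1 / 2 * ln (Gamma (x + 2 * h))"
    using convex_onD[OF log_convex_Gamma_real, of "1 / 2" x "x + 2 * h"] assms mid
    by (simp add: o_def)
  then have "ln (Gamma (x + h) * Gamma (x + h)) \<le> ln (Gamma x * Gamma (x + 2 * h))"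
    using pos by (simp add: ln_mult)
  then show ?thesis
    using pos by (simp add: field_simps)
qed

theorem corollary4:
  fixes \<alpha>1 \<beta>1 \<beta>2 B1 z :: real
  assumes "\<alpha>1 > 0" and "\<beta>1 > 0" and "\<beta>2 > 0" and "B1 \<ge> 0"
    and "\<alpha>1 \<ge> \<beta>2"
    and "z \<in> {0<..}"
  shows "Psi_tilde \<alpha>1 \<beta>2 B1 (\<beta>1 + 1) z / Psi_tilde \<alpha>1 \<beta>2 B1 \<beta>1 z
         + (Gamma \<beta>2 / Gamma \<alpha>1 * Psi_tilde \<alpha>1 \<beta>2 B1 (\<beta>1 + 1) z) powr (B1 / \<beta>1) \<ge> 2"
proof -
  define t where "t = B1 / \<beta>1"
  \<comment> \<open>\<open>C\<close> is the constant term of both series.\<close>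
  define C where "C = Gamma \<alpha>1 / Gamma \<beta>2"
  define p where "p k = Gamma (\<alpha>1 + real k) / Gamma (\<beta>2 + real k)" for k
  define q where "q k = 1 / Gamma (\<beta>1 + 1 + real k * B1)" for k
  define a where "a k = (p k / C) * (Gamma (\<beta>1 + 1) * q k)" for k
  have z: "z > 0" and t: "t \<ge> 0"
    using assms by (auto simp: t_def)
  have C: "C > 0"
    using assms by (simp add: C_def Gamma_real_pos)
  have ppos: "p k > 0" for k
    using assms by (simp add: p_def Gamma_real_pos)
  have qpos: "q k > 0" for k
    using assms by (simp add: q_def Gamma_real_pos add_pos_nonneg)
  have G: "Gamma (\<beta>1 + 1) > 0" "Gamma \<beta>1 > 0"
    using assms by (simp_all add: Gamma_real_pos)
  have apos: "a k > 0" for k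
    using C ppos qpos G by (simp add: a_def)
  have a0: "a 0 = 1"
    using G C ppos[of 0] by (auto simp: a_def q_def p_def C_def)
  have pstep: "p (Suc k) / p k = 1 + (\<alpha>1 - \<beta>2) / (\<beta>2 + real k)" for k
  proof -
    have *: "Gamma (x + real (Suc k)) = (x + real k) * Gamma (x + real k)" if "x > 0" for x
      using Gamma_plus1[of "x + real k"] that by (simp add: add_ac nonpos_Ints_def)
    have "p (Suc k) = (\<alpha>1 + real k) / (\<beta>2 + real k) * p k"
      using assms by (simp only: p_def * times_divide_times_eq)
    then have "p (Suc k) / p k = (\<alpha>1 + real k) / (\<beta>2 + real k)"
      using ppos[of k] by simp
    then show ?thesis
      using assms by (simp add: field_simps)
  qed
  have dec: "decseq (\<lambda>k. a (Suc k) / a k)"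
  proof (rule decseq_SucI)
    fix k
    have eq: "a (Suc j) / a j = (p (Suc j) / p j) * (q (Suc j) / q j)" for j
      using C G by (simp add: a_def)
    have "p (Suc (Suc k)) / p (Suc k) \<le> p (Suc k) / p k"
      using assms by (simp only: pstep) (auto intro!: divide_left_mono mult_pos_pos)
    moreover have "q (Suc (Suc k)) / q (Suc k) \<le> q (Suc k) / q k"
      using Gamma_quotient_mono[of "\<beta>1 + 1 + real k * B1" B1] assms
      by (simp add: q_def algebra_simps add_pos_nonneg)
    ultimately show "a (Suc (Suc k)) / a (Suc k) \<le> a (Suc k) / a k"
      unfolding eq using ppos qpos by (intro mult_mono) (auto simp: less_imp_le)
  qed
  have summ: "summable (\<lambda>k. a k / fact k * x ^ k)" for x
    using apos dec by (rule summable_egf)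
  define g where "g = egf a z"
  define g' where "g' = egf (\<lambda>k. a (Suc k)) z"
  have g: "g \<ge> 1"
    using egf_pos[OF apos dec, of z] a0 z by (simp add: g_def)
  have "egf (\<lambda>k. a (Suc k)) z \<ge> a (Suc 0)"
    using dec z by (intro egf_pos(1) apos) (auto simp: decseq_def)
  then have g': "g' \<ge> 0"
    using apos[of "Suc 0"] by (simp add: g'_def)

  have upper: "Psi_tilde \<alpha>1 \<beta>2 B1 (\<beta>1 + 1) z = C * g"
  proof -
    have coeff: "Gamma (\<alpha>1 + real k) / (Gamma (\<beta>1 + 1 + real k * B1) * Gamma (\<beta>2 + real k)) * (z ^ k / fact k)
        = C / Gamma (\<beta>1 + 1) * (a k / fact k * z ^ k)" for k
      using C G by (simp add: a_def p_def q_def)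
    show ?thesis
      unfolding Psi_tilde_series coeff suminf_mult[OF summ] g_def egf_def using G by simp
  qed
  have lower: "Psi_tilde \<alpha>1 \<beta>2 B1 \<beta>1 z = C * (g + t * (z * g'))"
  proof -
    have coeff: "Gamma (\<alpha>1 + real k) / (Gamma (\<beta>1 + real k * B1) * Gamma (\<beta>2 + real k)) * (z ^ k / fact k)
        = C / Gamma \<beta>1 * ((1 + t * real k) * (a k / fact k * z ^ k))" for k
    proof -
      \<comment> \<open>\<open>\<Gamma>(x + 1) = x \<Gamma>(x)\<close> at \<open>x = \<beta>1\<close> and at \<open>x = \<beta>1 + k B1\<close>; the two factors \<open>x\<close>
        have the quotient \<open>1 + t k\<close>.\<close>
      have pos: "\<beta>1 + real k * B1 > 0"
        using assms by (simp add: add_pos_nonneg)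
      have b: "Gamma (\<beta>1 + 1) = \<beta>1 * Gamma \<beta>1"
        using Gamma_plus1[of \<beta>1] assms by (simp add: nonpos_Ints_def)
      have "Gamma (\<beta>1 + 1 + real k * B1) = (\<beta>1 + real k * B1) * Gamma (\<beta>1 + real k * B1)"
        using Gamma_plus1[of "\<beta>1 + real k * B1"] pos by (simp add: nonpos_Ints_def add_ac)
      then have "(1 + t * real k) * (Gamma (\<beta>1 + 1) * q k)
          = (\<beta>1 * (1 + t * real k)) * Gamma \<beta>1 / ((\<beta>1 + real k * B1) * Gamma (\<beta>1 + real k * B1))"
        by (simp only: q_def b) simp
      also have "\<beta>1 * (1 + t * real k) = \<beta>1 + real k * B1"
        using assms by (simp add: t_def field_simps)
      finally have "(1 + t * real k) * (Gamma (\<beta>1 + 1) * q k) = Gamma \<beta>1 / Gamma (\<beta>1 + real k * B1)"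
        using pos by simp
      then have ak: "(1 + t * real k) * a k = (p k / C) * (Gamma \<beta>1 / Gamma (\<beta>1 + real k * B1))"
        unfolding a_def by (metis mult.left_commute)
      have "C / Gamma \<beta>1 * ((1 + t * real k) * (a k / fact k * z ^ k))
          = C / Gamma \<beta>1 * ((1 + t * real k) * a k) * (z ^ k / fact k)"
        by simp
      then show ?thesis
        unfolding ak using C G by (simp add: p_def)
    qed
    show ?thesis
      unfolding Psi_tilde_series coeff g_def g'_def
        sums_unique[OF sums_mult[OF sums_egf_affine[OF summ]], symmetric]
      using G by simp
  qed

  define u where "u = t * ln g"
  have u: "u \<ge> 0"
    using t g by (simp add: u_def)
  have "t * (z * g' / g) \<le> u"
    unfolding u_def using log_derivative_egf_le_ln[OF apos dec a0 z] t
    by (intro mult_left_mono) (simp_all add: g_def g'_def)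
  then have "g + t * (z * g') \<le> g * (1 + u)"
    using g by (simp add: field_simps)
  moreover have "g + t * (z * g') > 0"
    using g g' t z by (simp add: add_pos_nonneg)
  ultimately have ratio: "g / (g + t * (z * g')) \<ge> 1 / (1 + u)"
    using g u by (simp add: field_simps)
  have "g powr t \<ge> 1 + u"
    using g exp_ge_add_one_self[of u] by (simp add: powr_def u_def)
  moreover have "1 / (1 + u) + (1 + u) \<ge> 2"
    using u by (simp add: field_simps power2_eq_square)
  ultimately have "g / (g + t * (z * g')) + g powr t \<ge> 2"
    using ratio by linarith
  moreover have "Gamma \<beta>2 / Gamma \<alpha>1 * (C * g) = g"
    using assms by (simp add: C_def Gamma_real_pos less_imp_neq[symmetric])
  ultimately show ?thesis
    using C by (simp add: upper lower t_def)
qed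

end
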